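(* Let $n\ge 2$ be an integer, and let $f:[1,n]\to\mathbb{R}$ and $\sigma:[1,n]\to\mathbb{R}_+$ be bounded measurable functions that are constant on each yearly interval: for real numbers $f_j$ and $\sigma_j\ge 0$, $$f_t=f_j,\qquad \sigma_t=\sigma_j\qquad\text{for } t\in[j,j+1),\ 1\le j\le n-1 .$$ For $1\le j\le n-1$ let $$F_j := e^{\int_{j}^{j+1}f_u\,du},\qquad \Sigma_j^2 := \int_{j}^{j+1}\sigma_u^2\,e^{\int_{j}^u f_z\, dz + \int_{u}^{j+1} 2f_z\, dz}\,du .$$ Then for every $1\le j\le n-1$ these relations simplify to $$F_j = e^{f_j},\qquad \Sigma^2_j = \frac{\sigma_j^2}{f_j}\left(e^{2f_j} - e^{f_j}\right),$$ and these two relations are equivalent to $$f_j = \log(F_j),\qquad \sigma^2_j = \frac{\Sigma_j^2 \log(F_j)}{F_j(F_j-1)} .$$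
   Context: The functions $f,\sigma$ are the coefficients of the stochastic differential equation $dC_t=f_tC_t\,dt+\sigma_t\sqrt{C_t}\,dW_t$ on $[1,n]$, where $W$ is a Brownian motion and $C$ is the non-negative strong solution. With $\mathcal{F}_j$ the information generated by $C_1$ and by $W$ up to time $j$, the constants $F_j$ and $\Sigma_j^2$ are the one-year conditional mean and variance factors: $\mathbb{E}(C_{j+1}\mid\mathcal{F}_j)=F_jC_j$ and $\mathrm{Var}(C_{j+1}\mid\mathcal{F}_j)=\Sigma_j^2C_j$. Only the displayed definitions are needed for the statement.
   Formalization: When f_j = 0 (equivalently F_j = 1) the displayed quotients are 0/0 and undefined; there they are read as their limits, Σ_j² = σ_j² and σ_j² = Σ_j². All other cases are as displayed. *)

theory Defs
  imports "HOL-Analysis.Analysis" "HOL-Real_Asymp.Real_Asymp"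
begin

text \<open>The functions \<open>f\<close>, \<open>\<sigma>\<close> live on \<open>[1,n]\<close>; only their values there matter below.\<close>

definition mean_factor :: "(real \<Rightarrow> real) \<Rightarrow> nat \<Rightarrow> real" where
  "mean_factor f j = exp (LBINT u:{real j..real (j + 1)}. f u)"

text \<open>This is \<open>\<Sigma>\<^sub>j\<^sup>2\<close> itself, not \<open>\<Sigma>\<^sub>j\<close>.\<close>

definition variance_factor :: "(real \<Rightarrow> real) \<Rightarrow> (real \<Rightarrow> real) \<Rightarrow> nat \<Rightarrow> real" where
  "variance_factor f \<sigma> j =
     (LBINT u:{real j..real (j + 1)}.
        (\<sigma> u)\<^sup>2 * exp ((LBINT z:{real j..u}. f z) + (LBINT z:{u..real (j + 1)}. 2 * f z)))"

text \<open>
  The quotient \<open>\<sigma>\<^sup>2 / \<phi> * (exp (2\<phi>) - exp \<phi>)\<close> has a removable singularity at \<open>\<phi> = 0\<close>, and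
  \<open>\<Sigma>\<^sup>2 * ln F / (F * (F - 1))\<close> has one at \<open>F = 1\<close>. A zero growth rate is allowed, so both are
  read as continuously extended; with division by zero yielding \<open>0\<close>, the bare quotients
  would give a wrong value there. The lemmas below confirm the values chosen.
\<close>

definition variance_of_params :: "real \<Rightarrow> real \<Rightarrow> real" where
  "variance_of_params s2 \<phi> =
     (if \<phi> = 0 then s2 else s2 / \<phi> * (exp (2 * \<phi>) - exp \<phi>))"

definition volatility_sq_of_factors :: "real \<Rightarrow> real \<Rightarrow> real" where
  "volatility_sq_of_factors V F =
     (if F = 1 then V else V * ln F / (F * (F - 1)))"

lemma variance_of_params_tendsto:
  "((\<lambda>\<phi>. s2 / \<phi> * (exp (2 * \<phi>) - exp \<phi>)) \<longlongrightarrow> variance_of_params s2 0) (at (0::real))"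
proof -
  have "((\<lambda>\<phi>::real. (exp (2 * \<phi>) - exp \<phi>) / \<phi>) \<longlongrightarrow> 1) (at 0)"
    by real_asymp
  from tendsto_mult_left[OF this, of s2] show ?thesis
    by (simp add: variance_of_params_def)
qed

lemma volatility_sq_of_factors_tendsto:
  "((\<lambda>F. V * ln F / (F * (F - 1))) \<longlongrightarrow> volatility_sq_of_factors V 1) (at (1::real))"
proof -
  have "((\<lambda>F::real. ln F / (F * (F - 1))) \<longlongrightarrow> 1) (at 1)"
    by real_asymp
  from tendsto_mult_left[OF this, of V] show ?thesis
    by (simp add: volatility_sq_of_factors_def)
qed

end

theory Submission
  imports Defs
begin

text \<open>On one year \<open>f\<close> is a constant \<phi> and \<sigma> a constant
  \<open>s\<close>, except perhaps at the right end point, which is a null set. So the exponent in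
  \<open>variance_factor\<close> is \<phi>(u - j) + 2\<phi>(j + 1 - u) = \<phi>(j + 2 - u), and
  integrating its exponential over the year gives (e^(2\<phi>) - e^\<phi>)/\<phi>, or 1 if \<phi> =
  0 (\<open>variance_factor_eq\<close>). For the inversion put F = e^\<phi>: then e^(2\<phi>) -
  e^\<phi> = F(F - 1), so the variance is the squared volatility times the nonzero factor F(F -
  1)/ln F, which can be divided out (\<open>variance_of_params_iff_volatility_sq\<close>).\<close>

text \<open>Changing an integrand at the single point \<open>b\<close> needs no measurability.\<close>

lemma set_integral_Icc_cong_Ico:
  fixes f g :: "real \<Rightarrow> real"
  assumes "\<And>x. x \<in> {a..<b} \<Longrightarrow> f x = g x"
  shows "(LBINT x:{a..b}. f x) = (LBINT x:{a..b}. g x)"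
  unfolding set_lebesgue_integral_def
  by (rule integral_discrete_difference[where X = "{b}"])
     (auto simp: assms indicator_def)

lemma set_integral_Icc_const_on_Ico:
  fixes f :: "real \<Rightarrow> real"
  assumes "a \<le> b" and "\<And>x. x \<in> {a..<b} \<Longrightarrow> f x = c"
  shows "(LBINT x:{a..b}. f x) = c * (b - a)"
proof -
  have "(LBINT x:{a..b}. f x) = (LBINT x:{a..b}. c)"
    by (rule set_integral_Icc_cong_Ico) (rule assms(2))
  with assms(1) show ?thesis
    by (simp add: set_integral_const)
qed

lemma set_integral_exp_discount:
  fixes a \<phi> :: real
  assumes "\<phi> \<noteq> 0"
  shows "(LBINT u:{a..a + 1}. exp (\<phi> * (a + 2 - u))) = (exp (2 * \<phi>) - exp \<phi>) / \<phi>"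
proof -
  have "(LBINT u:{a..a + 1}. exp (\<phi> * (a + 2 - u)))
      = - exp (\<phi> * (a + 2 - (a + 1))) / \<phi> - (- exp (\<phi> * (a + 2 - a)) / \<phi>)"
    unfolding set_lebesgue_integral_def real_scaleR_def
    by (subst mult.commute, rule integral_FTC_Icc_real)
       (use assms in \<open>auto intro!: derivative_eq_intros continuous_intros\<close>)
  then show ?thesis
    by (simp add: diff_divide_distrib mult.commute)
qed

lemma mean_factor_eq:
  assumes "\<And>t. t \<in> {real j..<real (j + 1)} \<Longrightarrow> f t = \<phi>"
  shows "mean_factor f j = exp \<phi>"
  unfolding mean_factor_def
  by (subst set_integral_Icc_const_on_Ico[where c = \<phi>]) (use assms in auto)

lemma variance_factor_eq:
  assumes f: "\<And>t. t \<in> {real j..<real (j + 1)} \<Longrightarrow> f t = \<phi>"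
    and \<sigma>: "\<And>t. t \<in> {real j..<real (j + 1)} \<Longrightarrow> \<sigma> t = s"
  shows "variance_factor f \<sigma> j = variance_of_params (s\<^sup>2) \<phi>"
proof -
  have "variance_factor f \<sigma> j
      = (LBINT u:{real j..real (j + 1)}. s\<^sup>2 * exp (\<phi> * (real j + 2 - u)))"
    unfolding variance_factor_def
  proof (rule set_integral_Icc_cong_Ico)
    fix u assume u: "u \<in> {real j..<real (j + 1)}"
    \<comment> \<open>As u < j + 1, both inner integrals stay within the year, and only the second
      one meets the end point j + 1, where \<open>f\<close> may jump.\<close>
    have "(LBINT z:{real j..u}. f z) = \<phi> * (u - real j)"
      by (rule set_integral_Icc_const_on_Ico) (use u f in auto)
    moreover have "(LBINT z:{u..real (j + 1)}. 2 * f z) = 2 * \<phi> * (real (j + 1) - u)"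
      by (rule set_integral_Icc_const_on_Ico) (use u f in auto)
    ultimately have "(LBINT z:{real j..u}. f z) + (LBINT z:{u..real (j + 1)}. 2 * f z)
        = \<phi> * (real j + 2 - u)"
      by (simp add: algebra_simps)
    with \<sigma>[OF u] show "(\<sigma> u)\<^sup>2 *
        exp ((LBINT z:{real j..u}. f z) + (LBINT z:{u..real (j + 1)}. 2 * f z))
      = s\<^sup>2 * exp (\<phi> * (real j + 2 - u))"
      by simp
  qed
  also have "\<dots> = s\<^sup>2 * (LBINT u:{real j..real j + 1}. exp (\<phi> * (real j + 2 - u)))"
    by (simp add: add.commute)
  also have "\<dots> = variance_of_params (s\<^sup>2) \<phi>"
  \<comment> \<open>For zero growth the integrand is 1 on an interval of length 1, which yields
    exactly the continuously extended value \<open>s\<^sup>2\<close>.\<close>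
  proof (cases "\<phi> = 0")
    case True
    then show ?thesis
      by (simp add: variance_of_params_def set_integral_const)
  next
    case False
    then show ?thesis
      by (simp add: variance_of_params_def set_integral_exp_discount)
  qed
  finally show ?thesis .
qed

text \<open>Since exp \<phi> = 1 only for \<phi> = 0, the exceptional cases of the two definitions
  coincide, and there both sides say V = v. Otherwise V is v times a nonzero factor.\<close>

lemma variance_of_params_iff_volatility_sq:
  "V = variance_of_params v \<phi> \<longleftrightarrow> v = volatility_sq_of_factors V (exp \<phi>)"
proof (cases "\<phi> = 0")
  case True
  then show ?thesis
    by (auto simp: variance_of_params_def volatility_sq_of_factors_def)
next
  case False
  \<comment> \<open>This is F(F - 1) with F = exp \<phi>, the denominator in
    \<open>volatility_sq_of_factors\<close>.\<close>
  have "exp (2 * \<phi>) - exp \<phi> = exp \<phi> * (exp \<phi> - 1)"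
    by (simp only: exp_double power2_eq_square right_diff_distrib mult_1_right)
  moreover have "exp \<phi> * (exp \<phi> - 1) \<noteq> 0"
    using False by simp
  ultimately show ?thesis
    using False
    by (auto simp: variance_of_params_def volatility_sq_of_factors_def divide_simps mult.commute)
qed

text \<open>Positivity of F makes F = exp \<phi> the same as \<phi> = ln F; substituting it leaves
  the equivalence for the variances.\<close>

lemma factors_iff_params:
  assumes "F > 0"
  shows "F = exp \<phi> \<and> V = variance_of_params v \<phi> \<longleftrightarrow>
         \<phi> = ln F \<and> v = volatility_sq_of_factors V F"
  using assms variance_of_params_iff_volatility_sq[of V v \<phi>] by auto

theorem lemma3p10:
  fixes n :: nat
    and f \<sigma> :: "real \<Rightarrow> real"
    and fy \<sigma>y :: "nat \<Rightarrow> real"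
  assumes "n \<ge> 2"
    and "f \<in> borel_measurable (restrict_space borel {1..real n})"
    and "\<sigma> \<in> borel_measurable (restrict_space borel {1..real n})"
    and "bounded (f ` {1..real n})"
    and "bounded (\<sigma> ` {1..real n})"
    and "\<And>t. t \<in> {1..real n} \<Longrightarrow> \<sigma> t \<ge> 0"
    and "\<And>j. j \<in> {1..n - 1} \<Longrightarrow> \<sigma>y j \<ge> 0"
    and "\<And>j t. j \<in> {1..n - 1} \<Longrightarrow> t \<in> {real j..<real (j + 1)} \<Longrightarrow> f t = fy j"
    and "\<And>j t. j \<in> {1..n - 1} \<Longrightarrow> t \<in> {real j..<real (j + 1)} \<Longrightarrow> \<sigma> t = \<sigma>y j"
  shows "(\<forall>j\<in>{1..n - 1}.
            mean_factor f j = exp (fy j) \<and>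
            variance_factor f \<sigma> j = variance_of_params ((\<sigma>y j)\<^sup>2) (fy j) \<and>
            fy j = ln (mean_factor f j) \<and>
            (\<sigma>y j)\<^sup>2 = volatility_sq_of_factors (variance_factor f \<sigma> j) (mean_factor f j)) \<and>
         (\<forall>\<phi> s F V :: real. F > 0 \<longrightarrow>
            (F = exp \<phi> \<and> V = variance_of_params (s\<^sup>2) \<phi>) \<longleftrightarrow>
            (\<phi> = ln F \<and> s\<^sup>2 = volatility_sq_of_factors V F))"
proof (intro conjI ballI)
  fix j assume "j \<in> {1..n - 1}"
  note step = assms(8)[OF this] assms(9)[OF this]
  show M: "mean_factor f j = exp (fy j)"
    by (rule mean_factor_eq) (rule step)
  show V: "variance_factor f \<sigma> j = variance_of_params ((\<sigma>y j)\<^sup>2) (fy j)"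
    by (rule variance_factor_eq) (rule step, assumption)+
  show "fy j = ln (mean_factor f j)"
    by (simp add: M)
  show "(\<sigma>y j)\<^sup>2 = volatility_sq_of_factors (variance_factor f \<sigma> j) (mean_factor f j)"
    \<comment> \<open>Once the mean factor is written as an exponential, the equivalence turns the
      goal back into \<open>V\<close>.\<close>
    using V by (simp only: M variance_of_params_iff_volatility_sq)
next
  show "\<forall>\<phi> s F V :: real. F > 0 \<longrightarrow>
      (F = exp \<phi> \<and> V = variance_of_params (s\<^sup>2) \<phi>) \<longleftrightarrow>
      (\<phi> = ln F \<and> s\<^sup>2 = volatility_sq_of_factors V F)"
    by (intro allI impI factors_iff_params)
qed

end
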